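(* Let $\mathbb{X},\mathbb{Y}$ be normed linear spaces over the same field $\mathbb{K}\in\{\mathbb{R},\mathbb{C}\}$, let $F$ be a face of $B_{\mathbb{X}}$, and let $T:\mathbb{X}\to\mathbb{Y}$ be a bounded linear operator. If each element of $A\subset\mathrm{Int}_r\,F$ is a level vector of $T$, then the following are true: (i) If $T$ preserves Birkhoff-James orthogonality at a point $x\in A$ with respect to $\ker f$ for some $f\in J(x)$, then $T$ preserves Birkhoff-James orthogonality at each point of $A$ with respect to $\ker f$. Moreover, there exists $g\in\bigcap_{a\in A}J(Ta)$ such that $T(\ker f)\subset\ker g$, unless $T(A)=\{0\}$. (ii) There exists a face $G$ of $B_{\mathbb{Y}}$ such that $\frac{Tu}{\|Tu\|}\in G$ for all $u\in A$, unless $T(A)=\{0\}$. (iii) Each element of $\mathrm{co}(A)$ is a level vector of $T$.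
   Context: A semi-inner product on a normed space $\mathbb{X}$ over $\mathbb{K}$ is a function $[\cdot,\cdot]:\mathbb{X}\times\mathbb{X}\to\mathbb{K}$ such that for all $\alpha,\beta\in\mathbb{K}$, $x,y,z\in\mathbb{X}$: (1) $[\alpha x+\beta y,z]=\alpha[x,z]+\beta[y,z]$; (2) $[x,x]>0$ whenever $x\neq0$; (3) $|[x,y]|^2\le[x,x][y,y]$; (4) $[x,\alpha y]=\overline{\alpha}[x,y]$. All semi-inner products on a normed space are assumed compatible with the norm: $\|x\|=[x,x]^{1/2}$ for all $x$. For a bounded linear operator $T:\mathbb{X}\to\mathbb{Y}$, a nonzero $x\in\mathbb{X}$ is a level vector of $T$ if there exist a scalar $k$ (a level number of $T$ corresponding to $x$) and semi-inner products $[\cdot,\cdot]_{\mathbb{X}}$ on $\mathbb{X}$ and $[\cdot,\cdot]_{\mathbb{Y}}$ on $\mathbb{Y}$ with $[Ty,Tx]_{\mathbb{Y}}=k[y,x]_{\mathbb{X}}$ for all $y\in\mathbb{X}$. $B_{\mathbb{X}}$ and $S_{\mathbb{X}}$ are the closed unit ball and unit sphere. A convex set $F\subset S_{\mathbb{X}}$ is a face of $B_{\mathbb{X}}$ if for any $u,v\in S_{\mathbb{X}}$ and $0<t<1$, $(1-t)u+tv\in F$ implies $u,v\in F$. For nonempty $D\subset\mathbb{X}$, $\mathrm{aff}(D)$ is the intersection of all affine spaces (translates of subspaces of $\mathbb{X}$) containing $D$, and $\mathrm{Int}_r\,D=\{x\in D:\exists\,\epsilon>0,\ B(x,\epsilon)\cap\mathrm{aff}(D)\subseteq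 D\}$. $\mathrm{co}$ denotes convex hull. For nonzero $x\in\mathbb{X}$, $J(x)=\{f\in\mathbb{X}^*:\|f\|=1,\ f(x)=\|x\|\}$ (similarly in $\mathbb{Y}$). Birkhoff-James orthogonality: $u\perp_B v$ means $\|u+\lambda v\|\ge\|u\|$ for all scalars $\lambda\in\mathbb{K}$; $x^{\perp_B}=\{v: x\perp_B v\}$. $T$ preserves Birkhoff-James orthogonality at $x$ with respect to a subspace $\mathbb{Z}\subset x^{\perp_B}$ if $Tx\perp_B Tz$ for all $z\in\mathbb{Z}$. *)

theory Defs
  imports "HOL-Analysis.Analysis"
begin

text \<open>The scalar field: a normed field identified with the real or the complex numbers by an
  isometric embedding into \<^typ>\<open>complex\<close>.  Real parts and conjugates of scalars are taken
  through this embedding.\<close>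

class real_or_complex = real_normed_field +
  fixes emb :: "'a \<Rightarrow> complex"
  assumes emb_add: "emb (a + b) = emb a + emb b"
    and emb_mult: "emb (a * b) = emb a * emb b"
    and emb_scaleR: "emb (r *\<^sub>R a) = r *\<^sub>R emb a"
    and norm_emb: "norm (emb a) = norm a"
    and range_emb: "range emb = \<real> \<or> range emb = UNIV"

lemma emb_one: "emb (1::'a::real_or_complex) = 1"
proof -
  have "emb (1::'a) * emb (1::'a) = emb (1::'a)"
    using emb_mult[of "1::'a" 1] by simp
  moreover have "emb (1::'a) \<noteq> 0"
    using norm_emb[of "1::'a"] by auto
  ultimately show ?thesis by simp
qed

lemma emb_of_real: "emb (of_real r :: 'a::real_or_complex) = complex_of_real r"
  by (simp add: of_real_def emb_scaleR emb_one)

instantiation real :: real_or_complex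
begin
definition emb_real :: "real \<Rightarrow> complex" where "emb_real r = complex_of_real r"
instance by standard (auto simp: emb_real_def Reals_def scaleR_conv_of_real)
end

instantiation complex :: real_or_complex
begin
definition emb_complex :: "complex \<Rightarrow> complex" where "emb_complex z = z"
instance by standard (auto simp: emb_complex_def)
end

text \<open>A normed space over \<open>'k\<close>.  The norm and the multiplication by real scalars come from
  \<^class>\<open>real_normed_vector\<close>; \<open>scale\<close> extends the latter to all of \<open>'k\<close>.\<close>

locale normed_space_over = vector_space scale
  for scale :: "'k::real_or_complex \<Rightarrow> 'x::real_normed_vector \<Rightarrow> 'x" +
  assumes scale_of_real: "scale (of_real r) x = r *\<^sub>R x"
    and norm_scale: "norm (scale a x) = norm a * norm x"

lemma normed_space_over_real:
  "normed_space_over (scaleR :: real \<Rightarrow> 'x::real_normed_vector \<Rightarrow> 'x)"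
  by standard (auto simp: algebra_simps)

lemma normed_space_over_self:
  "normed_space_over ((*) :: 'k::real_or_complex \<Rightarrow> 'k \<Rightarrow> 'k)"
  by standard (auto simp: algebra_simps norm_mult scaleR_conv_of_real)

definition bounded_linear_over ::
  "('k::real_or_complex \<Rightarrow> 'x::real_normed_vector \<Rightarrow> 'x) \<Rightarrow>
   ('k \<Rightarrow> 'y::real_normed_vector \<Rightarrow> 'y) \<Rightarrow> ('x \<Rightarrow> 'y) \<Rightarrow> bool" where
  "bounded_linear_over sX sY T \<longleftrightarrow>
     Vector_Spaces.linear sX sY T \<and> (\<exists>C. \<forall>x. norm (T x) \<le> C * norm x)"

definition semi_inner_product ::
  "('k::real_or_complex \<Rightarrow> 'x::real_normed_vector \<Rightarrow> 'x) \<Rightarrow> ('x \<Rightarrow> 'x \<Rightarrow> 'k) \<Rightarrow> bool" where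
  "semi_inner_product s p \<longleftrightarrow>
     (\<forall>a b x y z. p (s a x + s b y) z = a * p x z + b * p y z) \<and>
     (\<forall>x. x \<noteq> 0 \<longrightarrow> (\<exists>r>0. p x x = of_real r)) \<and>
     (\<forall>x y. (norm (p x y))\<^sup>2 \<le> Re (emb (p x x)) * Re (emb (p y y))) \<and>
     (\<forall>a x y. emb (p x (s a y)) = cnj (emb a) * emb (p x y)) \<and>
     (\<forall>x. norm x = sqrt (Re (emb (p x x))))"

definition level_number ::
  "('k::real_or_complex \<Rightarrow> 'x::real_normed_vector \<Rightarrow> 'x) \<Rightarrow>
   ('k \<Rightarrow> 'y::real_normed_vector \<Rightarrow> 'y) \<Rightarrow> ('x \<Rightarrow> 'y) \<Rightarrow> 'x \<Rightarrow> 'k \<Rightarrow> bool" where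
  "level_number sX sY T x k \<longleftrightarrow>
     (\<exists>p q. semi_inner_product sX p \<and> semi_inner_product sY q \<and>
        (\<forall>y. q (T y) (T x) = k * p y x))"

definition level_vector ::
  "('k::real_or_complex \<Rightarrow> 'x::real_normed_vector \<Rightarrow> 'x) \<Rightarrow>
   ('k \<Rightarrow> 'y::real_normed_vector \<Rightarrow> 'y) \<Rightarrow> ('x \<Rightarrow> 'y) \<Rightarrow> 'x \<Rightarrow> bool" where
  "level_vector sX sY T x \<longleftrightarrow> x \<noteq> 0 \<and> (\<exists>k. level_number sX sY T x k)"

text \<open>This is not the library's \<open>face_of\<close>: a face lies in the unit sphere, and only
  segments with endpoints on the sphere are tested.  The empty set is allowed.\<close>

definition face_unit_ball :: "'x::real_normed_vector set \<Rightarrow> bool" where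
  "face_unit_ball F \<longleftrightarrow> convex F \<and> F \<subseteq> sphere 0 1 \<and>
     (\<forall>u\<in>sphere 0 1. \<forall>v\<in>sphere 0 1. \<forall>t::real.
        0 < t \<and> t < 1 \<and> (1 - t) *\<^sub>R u + t *\<^sub>R v \<in> F \<longrightarrow> u \<in> F \<and> v \<in> F)"

text \<open>Affine spaces are translates of subspaces over the scalar field \<open>'k\<close>, so for complex
  scalars the hull is the complex affine hull rather than the (real) \<open>affine hull\<close> of the library.
  Convexity, on the other hand, always refers to real coefficients.\<close>

definition affine_space_over ::
  "('k::real_or_complex \<Rightarrow> 'x::real_normed_vector \<Rightarrow> 'x) \<Rightarrow> 'x set \<Rightarrow> bool" where
  "affine_space_over s M \<longleftrightarrow> (\<exists>a V. module.subspace s V \<and> M = (\<lambda>v. a + v) ` V)"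

definition aff_over ::
  "('k::real_or_complex \<Rightarrow> 'x::real_normed_vector \<Rightarrow> 'x) \<Rightarrow> 'x set \<Rightarrow> 'x set" where
  "aff_over s D = \<Inter>{M. affine_space_over s M \<and> D \<subseteq> M}"

definition rel_interior_over ::
  "('k::real_or_complex \<Rightarrow> 'x::real_normed_vector \<Rightarrow> 'x) \<Rightarrow> 'x set \<Rightarrow> 'x set" where
  "rel_interior_over s D = {x\<in>D. \<exists>e>0. ball x e \<inter> aff_over s D \<subseteq> D}"

text \<open>The set \<open>J(x)\<close> of norm-one functionals attaining their norm at \<open>x\<close>, defined for
  nonzero \<open>x\<close> only; at \<open>0\<close> it is made empty.\<close>

definition support_functionals ::
  "('k::real_or_complex \<Rightarrow> 'x::real_normed_vector \<Rightarrow> 'x) \<Rightarrow> 'x \<Rightarrow> ('x \<Rightarrow> 'k) set" where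
  "support_functionals s x =
     {f. x \<noteq> 0 \<and> bounded_linear_over s (*) f \<and> onorm f = 1 \<and> f x = of_real (norm x)}"

definition BJ_orthogonal ::
  "('k::real_or_complex \<Rightarrow> 'x::real_normed_vector \<Rightarrow> 'x) \<Rightarrow> 'x \<Rightarrow> 'x \<Rightarrow> bool" where
  "BJ_orthogonal s u v \<longleftrightarrow> (\<forall>a. norm (u + s a v) \<ge> norm u)"

definition preserves_BJ_at ::
  "('k::real_or_complex \<Rightarrow> 'x::real_normed_vector \<Rightarrow> 'x) \<Rightarrow>
   ('k \<Rightarrow> 'y::real_normed_vector \<Rightarrow> 'y) \<Rightarrow> ('x \<Rightarrow> 'y) \<Rightarrow> 'x \<Rightarrow> 'x set \<Rightarrow> bool" where
  "preserves_BJ_at sX sY T x Z \<longleftrightarrow>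
     module.subspace sX Z \<and> Z \<subseteq> {v. BJ_orthogonal sX x v} \<and>
     (\<forall>z\<in>Z. BJ_orthogonal sY (T x) (T z))"

definition kernel_of :: "('x \<Rightarrow> 'k::zero) \<Rightarrow> 'x set" where
  "kernel_of f = {z. f z = 0}"

end

theory Submission
  imports Defs
begin

text \<open>A functional supporting the ball at one point of the relative interior of a face \<open>F\<close> supports
  it at every point of \<open>F\<close>.  A level vector \<open>x\<close> of norm one with \<open>T x \<noteq> 0\<close> amounts to
  functionals \<open>h \<in> J(x)\<close>, \<open>g \<in> J(T x)\<close> with \<open>g \<circ> T = \<parallel>T x\<parallel> h\<close>; if \<open>x \<in> A\<close>, then \<open>h = 1\<close> on \<open>F\<close>,
  so \<open>g (T y) = \<parallel>T x\<parallel>\<close> for all \<open>y \<in> F\<close>.  By symmetry \<open>\<parallel>T a\<parallel>\<close> is constant on \<open>A\<close> and \<open>g\<close> supports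
  every \<open>T a\<close>, and also \<open>T z\<close> for \<open>z\<close> in the convex hull.  This gives (ii), with \<open>G\<close> the face
  exposed by \<open>g\<close>, and (iii).  For (i), the Hahn-Banach theorem turns the orthogonality of \<open>T x\<close>
  to \<open>T (ker f)\<close> into a functional in \<open>J(T x)\<close> vanishing on \<open>T (ker f)\<close>; as \<open>f\<close> is constant on \<open>A\<close>,
  this functional takes the value \<open>\<parallel>T x\<parallel>\<close> at every \<open>T a\<close>.\<close>

subsection \<open>The Hahn-Banach theorem\<close>

text \<open>Only one inequality is demanded for scaling, the one to be checked for an infimum.
  Applied to the inverse scalar it yields the other, as \<open>sublinear_scaleR\<close>
  shows.\<close>

definition sublinear :: "('a::real_vector \<Rightarrow> real) \<Rightarrow> bool" where
  "sublinear m \<longleftrightarrow>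
     (\<forall>x y. m (x + y) \<le> m x + m y) \<and> (\<forall>r\<ge>0. \<forall>x. m (r *\<^sub>R x) \<le> r * m x)"

lemma sublinear_add: "sublinear m \<Longrightarrow> m (x + y) \<le> m x + m y"
  by (simp add: sublinear_def)

lemma sublinear_zero:
  assumes "sublinear m"
  shows "m 0 = 0"
proof -
  have "m 0 \<le> m 0 + m 0"
    using sublinear_add[OF assms, of 0 0] by simp
  moreover have "m (0 *\<^sub>R 0) \<le> 0 * m 0"
    using assms unfolding sublinear_def by blast
  ultimately show ?thesis by simp
qed

lemma sublinear_scaleR:
  assumes "sublinear m" "r \<ge> 0"
  shows "m (r *\<^sub>R x) = r * m x"
proof (cases "r = 0")
  case True
  then show ?thesis by (simp add: sublinear_zero assms)
next
  case False
  with assms have r: "r > 0" by simp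
  have "m (inverse r *\<^sub>R (r *\<^sub>R x)) \<le> inverse r * m (r *\<^sub>R x)"
    using assms r unfolding sublinear_def by (meson less_imp_le positive_imp_inverse_positive)
  then have "r * m x \<le> m (r *\<^sub>R x)"
    using r by (simp add: field_simps)
  moreover have "m (r *\<^sub>R x) \<le> r * m x"
    using assms unfolding sublinear_def by blast
  ultimately show ?thesis by simp
qed

lemma sublinear_uminus:
  assumes "sublinear m"
  shows "- m (- x) \<le> m x"
  using sublinear_add[OF assms, of x "- x"] sublinear_zero[OF assms] by simp

lemma sublinear_norm: "sublinear norm"
  by (simp add: sublinear_def norm_triangle_ineq)

text \<open>\<open>m'\<close> is the infimal convolution of \<open>m\<close> with the functional that is \<open>d \<mapsto> - \<phi> (- d)\<close> on the
  cone \<open>- C\<close> and infinite elsewhere.\<close>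

lemma sublinear_shift:
  assumes m: "sublinear m"
    and C: "0 \<in> C" "\<And>c d. c \<in> C \<Longrightarrow> d \<in> C \<Longrightarrow> c + d \<in> C"
      "\<And>r c. r \<ge> 0 \<Longrightarrow> c \<in> C \<Longrightarrow> r *\<^sub>R c \<in> C"
    and \<phi>: "\<And>c d. c \<in> C \<Longrightarrow> d \<in> C \<Longrightarrow> \<phi> c + \<phi> d \<le> \<phi> (c + d)"
      "\<And>r c. r \<ge> 0 \<Longrightarrow> c \<in> C \<Longrightarrow> r * \<phi> c \<le> \<phi> (r *\<^sub>R c)"
      "\<And>c. c \<in> C \<Longrightarrow> \<phi> c \<le> m c"
  shows "\<exists>m'. sublinear m' \<and> (\<forall>x. m' x \<le> m x) \<and> (\<forall>c\<in>C. m' (- c) \<le> - \<phi> c) \<and>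
     (\<forall>x b. (\<forall>c\<in>C. b \<le> m (x + c) - \<phi> c) \<longrightarrow> b \<le> m' x)"
proof -
  define m' where "m' x = (INF c\<in>C. m (x + c) - \<phi> c)" for x
  \<comment> \<open>The infimum is finite because
    \<open>\<phi> c \<le> m c \<le> m (x + c) + m (- x)\<close>.\<close>
  have bdd: "bdd_below ((\<lambda>c. m (x + c) - \<phi> c) ` C)" for x
  proof (rule bdd_belowI2)
    fix c assume "c \<in> C"
    then show "- m (- x) \<le> m (x + c) - \<phi> c"
      using \<phi>(3)[of c] sublinear_add[OF m, of "x + c" "- x"] by simp
  qed
  have lower: "m' x \<le> m (x + c) - \<phi> c" if "c \<in> C" for x c
    unfolding m'_def by (rule cINF_lower[OF bdd that])
  have greatest: "b \<le> m' x" if "\<And>c. c \<in> C \<Longrightarrow> b \<le> m (x + c) - \<phi> c" for b x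
    unfolding m'_def by (rule cINF_greatest) (use C(1) that in auto)
  have \<phi>0: "\<phi> 0 = 0"
    using \<phi>(1)[OF C(1) C(1)] \<phi>(2)[of 0 0] C(1) by simp
  have "m' (x + y) \<le> m' x + m' y" for x y
  proof -
    \<comment> \<open>The infimum is taken over \<open>c\<close> for fixed \<open>d\<close>, and
      then over \<open>d\<close>.\<close>
    have "m' (x + y) - (m (y + d) - \<phi> d) \<le> m' x" if d: "d \<in> C" for d
    proof (rule greatest)
      fix c assume c: "c \<in> C"
      have "m' (x + y) \<le> m ((x + c) + (y + d)) - \<phi> (c + d)"
        using lower[OF C(2)[OF c d], of "x + y"] by (simp add: algebra_simps)
      also have "\<dots> \<le> m (x + c) + m (y + d) - \<phi> c - \<phi> d"
        using sublinear_add[OF m, of "x + c" "y + d"] \<phi>(1)[OF c d] by simp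
      finally show "m' (x + y) - (m (y + d) - \<phi> d) \<le> m (x + c) - \<phi> c" by simp
    qed
    then have "m' (x + y) - m' x \<le> m' y"
      by (intro greatest) (simp add: algebra_simps)
    then show ?thesis by simp
  qed
  moreover have "m' (r *\<^sub>R x) \<le> r * m' x" if r: "r \<ge> 0" for r x
  proof (cases "r = 0")
    case True
    then show ?thesis
      using lower[OF C(1), of 0] by (simp add: \<phi>0 sublinear_zero[OF m])
  next
    case False
    with r have r: "r > 0" by simp
    have "m' (r *\<^sub>R x) / r \<le> m' x"
    proof (rule greatest)
      fix c assume c: "c \<in> C"
      have "m' (r *\<^sub>R x) \<le> m (r *\<^sub>R x + r *\<^sub>R c) - \<phi> (r *\<^sub>R c)"
        using r c by (intro lower C(3)) auto
      also have "\<dots> \<le> r * m (x + c) - r * \<phi> c"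
        using sublinear_scaleR[OF m, of r "x + c"] \<phi>(2)[of r c] r c
        by (simp add: scaleR_add_right)
      finally show "m' (r *\<^sub>R x) / r \<le> m (x + c) - \<phi> c"
        using r by (simp add: field_simps)
    qed
    then show ?thesis using r by (simp add: field_simps)
  qed
  ultimately have "sublinear m'" by (simp add: sublinear_def)
  moreover have "m' x \<le> m x" for x
    using lower[OF C(1), of x] by (simp add: \<phi>0)
  moreover have "m' (- c) \<le> - \<phi> c" if "c \<in> C" for c
    using lower[OF that, of "- c"] by (simp add: sublinear_zero[OF m])
  ultimately show ?thesis
    using greatest by blast
qed

text \<open>Here \<open>C\<close> is the ray through \<open>z\<close> and \<open>\<phi>\<close> is
  \<open>m\<close> itself, which is additive on a ray. A linear functional below \<open>m'\<close>
  lies below \<open>m\<close> and has at least, hence exactly, the value \<open>m z\<close> at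
  \<open>z\<close>.\<close>

lemma sublinear_shift_ray:
  assumes m: "sublinear m"
  shows "\<exists>m'. sublinear m' \<and> (\<forall>x. m' x \<le> m x) \<and> m' (- z) \<le> - m z"
proof -
  let ?C = "(\<lambda>t. t *\<^sub>R z) ` {0..}"
  have "\<exists>m'. sublinear m' \<and> (\<forall>x. m' x \<le> m x) \<and> (\<forall>c\<in>?C. m' (- c) \<le> - m c) \<and>
     (\<forall>x b. (\<forall>c\<in>?C. b \<le> m (x + c) - m c) \<longrightarrow> b \<le> m' x)"
  proof (rule sublinear_shift[OF m])
    show "0 \<in> ?C" by (intro image_eqI[of _ _ 0]) auto
    show "c + d \<in> ?C" if "c \<in> ?C" "d \<in> ?C" for c d
      using that by (auto simp flip: scaleR_add_left)
    show "r *\<^sub>R c \<in> ?C" if "r \<ge> 0" "c \<in> ?C" for r c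
      using that by auto
    show "m c + m d \<le> m (c + d)" if "c \<in> ?C" "d \<in> ?C" for c d
      using that by (auto simp: sublinear_scaleR[OF m] distrib_right simp flip: scaleR_add_left)
    show "r * m c \<le> m (r *\<^sub>R c)" if "r \<ge> 0" for r c
      using that by (simp add: sublinear_scaleR[OF m])
  qed simp
  moreover have "z \<in> ?C" by (intro image_eqI[of _ _ 1]) auto
  ultimately show ?thesis by blast
qed

text \<open>By minimality the sublinear functional of \<open>sublinear_shift_ray\<close> is \<open>m\<close> itself, so \<open>m\<close> is odd.\<close>

lemma minimal_sublinear_linear:
  assumes m: "sublinear m"
    and min: "\<And>m'. sublinear m' \<Longrightarrow> (\<forall>x. m' x \<le> m x) \<Longrightarrow> m' = m"
  shows "linear m"
proof -
  have neg: "m (- z) = - m z" for z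
    using sublinear_shift_ray[OF m, of z] min sublinear_uminus[OF m, of "-z"]
    by (metis add.inverse_inverse antisym minus_le_iff)
  show ?thesis
  proof (rule linearI)
    fix x y
    have "m x \<le> m (x + y) + m (- y)"
      using sublinear_add[OF m, of "x + y" "- y"] by simp
    then show "m (x + y) = m x + m y"
      using sublinear_add[OF m, of x y] by (simp add: neg)
  next
    fix r x
    show "m (r *\<^sub>R x) = r *\<^sub>R m x"
    proof (cases "r \<ge> 0")
      case False
      then have "m ((- r) *\<^sub>R (- x)) = (- r) * m (- x)"
        by (intro sublinear_scaleR[OF m]) simp
      then show ?thesis by (simp add: neg)
    qed (simp add: sublinear_scaleR[OF m])
  qed
qed

text \<open>Provides the lower bounds for Zorn's lemma. The pointwise infimum is finite since every
  member is at least \<open>- q (- x)\<close> at \<open>x\<close>, and it is subadditive since of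
  two members of a chain one lies below both.\<close>

lemma sublinear_INF_chain:
  assumes ne: "C \<noteq> {}"
    and sub: "\<And>m. m \<in> C \<Longrightarrow> sublinear m"
    and chain: "\<And>m n. m \<in> C \<Longrightarrow> n \<in> C \<Longrightarrow> m \<le> n \<or> n \<le> m"
    and le: "\<And>m. m \<in> C \<Longrightarrow> m \<le> q"
  shows "\<exists>u. sublinear u \<and> (\<forall>m\<in>C. u \<le> m)"
proof -
  define u where "u x = (INF m\<in>C. m x)" for x
  have bdd: "bdd_below ((\<lambda>m. m x) ` C)" for x
  proof (rule bdd_belowI2)
    fix m assume m: "m \<in> C"
    have "- q (- x) \<le> - m (- x)" using le[OF m] by (simp add: le_fun_def)
    also have "\<dots> \<le> m x" by (rule sublinear_uminus[OF sub[OF m]])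
    finally show "- q (- x) \<le> m x" .
  qed
  have lower: "u x \<le> m x" if "m \<in> C" for m x
    unfolding u_def by (rule cINF_lower[OF bdd that])
  have greatest: "b \<le> u x" if "\<And>m. m \<in> C \<Longrightarrow> b \<le> m x" for b x
    unfolding u_def by (rule cINF_greatest) (use ne that in auto)
  have "u (x + y) \<le> u x + u y" for x y
  proof -
    have "u (x + y) - n y \<le> u x" if n: "n \<in> C" for n
    proof (rule greatest)
      fix m assume m: "m \<in> C"
      obtain k where k: "k \<in> C" "k \<le> m" "k \<le> n"
        using chain[OF m n] m n by blast
      have "u (x + y) \<le> k x + k y"
        using lower[OF k(1), of "x + y"] sublinear_add[OF sub[OF k(1)], of x y] by linarith
      also have "\<dots> \<le> m x + n y"
        using k by (intro add_mono) (auto simp: le_fun_def)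
      finally show "u (x + y) - n y \<le> m x" by simp
    qed
    then have "u (x + y) - u x \<le> u y"
      by (intro greatest) (simp add: algebra_simps)
    then show ?thesis by simp
  qed
  moreover have "u (r *\<^sub>R x) \<le> r * u x" if r: "r \<ge> 0" for r x
  proof (cases "r = 0")
    case True
    obtain m where "m \<in> C" using ne by blast
    then show ?thesis
      using lower[of m 0] sublinear_zero[OF sub, of m] True by simp
  next
    case False
    with r have r: "r > 0" by simp
    have "u (r *\<^sub>R x) / r \<le> u x"
    proof (rule greatest)
      fix m assume m: "m \<in> C"
      show "u (r *\<^sub>R x) / r \<le> m x"
        using lower[OF m, of "r *\<^sub>R x"] sublinear_scaleR[OF sub[OF m], of r x] r
        by (simp add: field_simps)
    qed
    then show ?thesis using r by (simp add: field_simps)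
  qed
  ultimately have "sublinear u" by (simp add: sublinear_def)
  then show ?thesis using lower by (auto simp: le_fun_def)
qed

text \<open>A minimal element among the sublinear functionals below \<open>q\<close> exists by
  Zorn's lemma, and it is linear by \<open>minimal_sublinear_linear\<close>.\<close>

theorem hahn_banach_sublinear:
  assumes q: "sublinear q"
  shows "\<exists>f. linear f \<and> (\<forall>x. f x \<le> q x)"
proof -
  define S where "S = {m. sublinear m \<and> m \<le> q}"
  \<comment> \<open>The order is reversed because Zorn's lemma delivers maximal elements.\<close>
  define P :: "('a \<Rightarrow> real) \<Rightarrow> ('a \<Rightarrow> real) \<Rightarrow> bool" where "P a b \<longleftrightarrow> b \<le> a" for a b
  have "\<exists>m\<in>S. \<forall>a\<in>S. P m a \<longrightarrow> a = m"
  proof (rule predicate_Zorn)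
    show "partial_order_on S (relation_of P S)"
      by (rule partial_order_on_relation_ofI) (auto simp: P_def)
  next
    fix C assume "C \<in> Chains (relation_of P S)"
    then have C: "\<And>m n. m \<in> C \<Longrightarrow> n \<in> C \<Longrightarrow> m \<le> n \<or> n \<le> m" "C \<subseteq> S"
      by (auto simp: Chains_def relation_of_def P_def)
    show "\<exists>u\<in>S. \<forall>a\<in>C. P a u"
    proof (cases "C = {}")
      case True
      then show ?thesis using q by (auto simp: S_def)
    next
      case False
      then obtain u where u: "sublinear u" "\<forall>m\<in>C. u \<le> m"
        using sublinear_INF_chain[of C q] C unfolding S_def by blast
      then have "u \<le> q"
        using False C(2) unfolding S_def by (blast intro: order_trans)
      with u show ?thesis by (auto simp: S_def P_def)
    qed
  qed
  then obtain m where m: "sublinear m" "m \<le> q" "\<And>a. a \<in> S \<Longrightarrow> a \<le> m \<Longrightarrow> a = m"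
    by (auto simp: S_def P_def)
  have "linear m"
  proof (rule minimal_sublinear_linear[OF m(1)])
    fix m' assume m': "sublinear m'" "\<forall>x. m' x \<le> m x"
    then have le: "m' \<le> m" by (simp add: le_fun_def)
    show "m' = m"
      by (rule m(3)) (use m' le m(2) in \<open>auto simp: S_def\<close>)
  qed
  then show ?thesis using m(2) by (auto simp: le_fun_def)
qed

text \<open>The norm is shifted twice. The zero functional on \<open>W\<close> turns it into the
  distance \<open>p\<close> to \<open>W\<close>, which by orthogonality is \<open>norm u\<close> at
  \<open>u\<close>; the ray through \<open>u\<close> then forces a linear functional below to attain
  this value.\<close>

theorem hahn_banach_orthogonal:
  fixes u :: "'a::real_normed_vector"
  assumes W: "subspace W" and orth: "\<And>w. w \<in> W \<Longrightarrow> norm u \<le> norm (u + w)"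
  shows "\<exists>f. linear f \<and> (\<forall>x. f x \<le> norm x) \<and> f u = norm u \<and> (\<forall>w\<in>W. f w = 0)"
proof -
  have "\<exists>p. sublinear p \<and> (\<forall>x. p x \<le> norm x) \<and> (\<forall>c\<in>W. p (- c) \<le> - 0) \<and>
     (\<forall>x b. (\<forall>c\<in>W. b \<le> norm (x + c) - 0) \<longrightarrow> b \<le> p x)"
    by (rule sublinear_shift[OF sublinear_norm])
      (use W in \<open>auto simp: subspace_0 subspace_add subspace_scale\<close>)
  then obtain p where p: "sublinear p" "\<And>x. p x \<le> norm x" "\<And>c. c \<in> W \<Longrightarrow> p (- c) \<le> 0"
      "\<And>x b. (\<forall>c\<in>W. b \<le> norm (x + c)) \<Longrightarrow> b \<le> p x"
    by auto
  obtain p' where p': "sublinear p'" "\<And>x. p' x \<le> p x" "p' (- u) \<le> - p u"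
    using sublinear_shift_ray[OF p(1), of u] by blast
  obtain f where f: "linear f" "\<And>x. f x \<le> p' x"
    using hahn_banach_sublinear[OF p'(1)] by blast
  have neg: "f (- x) = - f x" for x
    by (rule linear_neg[OF f(1)])
  have fp: "f x \<le> p x" for x
    using f(2) p'(2) order_trans by blast
  have le: "f w \<le> 0" if "w \<in> W" for w
    using p(3)[of "- w"] fp[of w] subspace_neg[OF W that] by simp
  have "f w = 0" if "w \<in> W" for w
    using le[OF that] le[OF subspace_neg[OF W that]] neg[of w] by simp
  moreover have "f u = norm u"
  proof (rule antisym)
    show "f u \<le> norm u" using fp p(2) order_trans by blast
    have "norm u \<le> p u" by (rule p(4)) (use orth in blast)
    then show "norm u \<le> f u" using f(2)[of "- u"] p'(3) neg[of u] by simp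
  qed
  moreover have "f x \<le> norm x" for x
    using fp p(2) order_trans by blast
  ultimately show ?thesis using f(1) by blast
qed

subsection \<open>Scalars\<close>

lemma emb_diff: "emb (a - b) = emb a - emb (b :: 'k::real_or_complex)"
proof -
  have "emb (a - b) + emb b = emb a" by (simp flip: emb_add)
  then show ?thesis by (simp add: eq_diff_eq)
qed

lemma emb_eq_iff: "emb a = emb b \<longleftrightarrow> a = (b :: 'k::real_or_complex)"
  using norm_emb[of "a - b"] by (auto simp: emb_diff)

lemma emb_zero: "emb (0 :: 'k::real_or_complex) = 0"
  using emb_of_real[of 0, where 'a = 'k] by simp

text \<open>Conjugation pulled back along \<open>emb\<close>. A value exists because the range of
  \<open>emb\<close>, the real line or the whole plane, is closed under conjugation; it is unique
  because \<open>emb\<close> is injective.\<close>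

definition kcnj :: "'k::real_or_complex \<Rightarrow> 'k" where
  "kcnj a = (SOME b. emb b = cnj (emb a))"

lemma emb_kcnj: "emb (kcnj a) = cnj (emb (a :: 'k::real_or_complex))"
proof -
  have "\<exists>b::'k. emb b = cnj (emb a)"
    using range_emb[where 'a = 'k]
  proof
    assume "range (emb :: 'k \<Rightarrow> complex) = \<real>"
    then have "cnj (emb a) = emb a" by (auto simp flip: Reals_cnj_iff)
    then show ?thesis by metis
  next
    assume "range (emb :: 'k \<Rightarrow> complex) = UNIV"
    then show ?thesis by (metis surjD)
  qed
  then show ?thesis unfolding kcnj_def by (rule someI_ex)
qed

lemma kcnj_mult_self: "kcnj a * a = of_real ((norm (a :: 'k::real_or_complex))\<^sup>2)"
proof -
  have "emb (kcnj a * a) = emb (of_real ((norm a)\<^sup>2) :: 'k)"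
    using complex_norm_square[of "emb a"]
    by (simp add: emb_mult emb_kcnj emb_of_real norm_emb mult.commute del: of_real_power)
  then show ?thesis by (simp add: emb_eq_iff)
qed

lemma norm_kcnj: "norm (kcnj (a :: 'k::real_or_complex)) = norm a"
  by (metis complex_mod_cnj emb_kcnj norm_emb)

lemma kcnj_of_real: "kcnj (of_real r :: 'k::real_or_complex) = of_real r"
  by (metis complex_cnj_complex_of_real emb_eq_iff emb_kcnj emb_of_real)

text \<open>The disc of radius \<open>r\<close> meets the half-plane of real part at least
  \<open>r\<close> only in the point \<open>r\<close>. This turns bounds on real parts into
  equations between scalars.\<close>

lemma eq_of_real_if_Re_ge:
  assumes "norm (c :: 'k::real_or_complex) \<le> r" "r \<le> Re (emb c)"
  shows "c = of_real r"
proof -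
  have "(cmod (emb c))\<^sup>2 \<le> r\<^sup>2" using assms(1) by (simp add: norm_emb power_mono)
  moreover have r: "0 \<le> r" using assms(1) norm_ge_zero order_trans by blast
  then have "r\<^sup>2 \<le> (Re (emb c))\<^sup>2" using assms(2) by (simp add: power_mono)
  ultimately have "(Im (emb c))\<^sup>2 \<le> 0" unfolding cmod_power2 by linarith
  then have "Im (emb c) = 0" by simp
  moreover have "Re (emb c) = r"
    using complex_Re_le_cmod[of "emb c"] assms by (simp add: norm_emb)
  ultimately have "emb c = emb (of_real r :: 'k)"
    by (simp add: emb_of_real complex_eq_iff)
  then show ?thesis by (simp add: emb_eq_iff)
qed

subsection \<open>Support functionals\<close>

lemma vector_space_self: "vector_space ((*) :: 'k::real_or_complex \<Rightarrow> 'k \<Rightarrow> 'k)"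
  using normed_space_over_self unfolding normed_space_over_def by blast

lemma bounded_linear_over_self_iff:
  fixes f :: "'x::real_normed_vector \<Rightarrow> 'k::real_or_complex"
  assumes "normed_space_over s"
  shows "bounded_linear_over s (*) f \<longleftrightarrow> (\<forall>x y. f (x + y) = f x + f y) \<and>
     (\<forall>a x. f (s a x) = a * f x) \<and> (\<exists>C. \<forall>x. norm (f x) \<le> C * norm x)"
  using assms vector_space_self
  unfolding bounded_linear_over_def Vector_Spaces.linear_iff normed_space_over_def by blast

text \<open>Replaces the operator norm by a pointwise bound: under the bound
  \<open>norm (f y) \<le> norm y\<close>, the value at \<open>x\<close> makes the operator norm
  exactly 1.\<close>

lemma support_functionals_iff:
  fixes f :: "'x::real_normed_vector \<Rightarrow> 'k::real_or_complex"
  assumes s: "normed_space_over s"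
  shows "f \<in> support_functionals s x \<longleftrightarrow> x \<noteq> 0 \<and> (\<forall>x y. f (x + y) = f x + f y) \<and>
     (\<forall>a x. f (s a x) = a * f x) \<and> (\<forall>y. norm (f y) \<le> norm y) \<and> f x = of_real (norm x)"
    (is "?L \<longleftrightarrow> ?R")
proof
  assume L: ?L
  then have f: "\<forall>x y. f (x + y) = f x + f y" "\<forall>a x. f (s a x) = a * f x"
      "\<exists>C. \<forall>x. norm (f x) \<le> C * norm x" "onorm f = 1" "x \<noteq> 0" "f x = of_real (norm x)"
    unfolding support_functionals_def bounded_linear_over_self_iff[OF s] by blast+
  have "f (r *\<^sub>R y) = r *\<^sub>R f y" for r y
    using f(2) normed_space_over.scale_of_real[OF s, of r y] by (metis scaleR_conv_of_real)
  moreover obtain C where "\<forall>x. norm (f x) \<le> C * norm x" using f(3) by blast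
  ultimately have "bounded_linear f"
    by (intro bounded_linear_intro[of _ C]) (use f in \<open>auto simp: mult.commute\<close>)
  from onorm[OF this] show ?R using f by simp
next
  assume R: ?R
  then have bl: "bounded_linear_over s (*) f"
    unfolding bounded_linear_over_self_iff[OF s] by (metis mult_1)
  have "onorm f \<le> 1" by (rule onorm_bound) (use R in auto)
  moreover have "norm (f x) / norm x \<le> onorm f"
    unfolding onorm_def
  proof (rule cSUP_upper)
    show "bdd_above (range (\<lambda>x. norm (f x) / norm x))"
      by (rule bdd_aboveI2[of _ _ 1]) (use R in \<open>auto simp: divide_le_eq_1\<close>)
  qed simp
  ultimately have "onorm f = 1" using R by simp
  then show ?L using R bl by (simp add: support_functionals_def)
qed

text \<open>Leads from real functionals to functionals over \<open>'k\<close>. For complex scalars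
  \<open>g x\<close> is \<open>f x - i f (i x)\<close>; it vanishes on \<open>W\<close> because
  \<open>W\<close> is closed under multiplication by \<open>i\<close>.\<close>

lemma complexify_functional:
  fixes s :: "'k::real_or_complex \<Rightarrow> 'x::real_normed_vector \<Rightarrow> 'x"
  assumes s: "normed_space_over s" and W: "module.subspace s W"
    and f: "linear f" "\<And>w. w \<in> W \<Longrightarrow> f w = 0"
  shows "\<exists>g :: 'x \<Rightarrow> 'k. (\<forall>x y. g (x + y) = g x + g y) \<and> (\<forall>a x. g (s a x) = a * g x) \<and>
     (\<forall>x. Re (emb (g x)) = f x) \<and> (\<forall>w\<in>W. g w = 0)"
proof -
  interpret normed_space_over s by fact
  note fsimps = linear_add[OF f(1)] linear_scale[OF f(1)] linear_neg[OF f(1)]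
  show ?thesis
    using range_emb[where 'a = 'k]
  proof
    assume R: "range (emb :: 'k \<Rightarrow> complex) = \<real>"
    have scalar: "\<exists>r. a = of_real r" for a :: 'k
    proof -
      have "emb a \<in> \<real>" using R by blast
      then obtain r where "emb a = complex_of_real r" by (auto elim: Reals_cases)
      then have "a = of_real r" by (metis emb_eq_iff emb_of_real)
      then show ?thesis ..
    qed
    show ?thesis
    proof (intro exI[of _ "\<lambda>x. of_real (f x)"] conjI allI ballI)
      fix a :: 'k and x
      obtain r where "a = of_real r" using scalar by blast
      then show "of_real (f (s a x)) = a * of_real (f x)"
        by (simp add: scale_of_real fsimps)
    qed (auto simp: fsimps emb_of_real f(2))
  next
    assume R: "range (emb :: 'k \<Rightarrow> complex) = UNIV"
    then obtain i :: 'k where i: "emb i = \<i>" by (metis surjD)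
    have ii: "i * i = - 1"
    proof -
      have "emb (i * i) = emb (of_real (- 1) :: 'k)" by (simp only: emb_mult i emb_of_real) simp
      then show ?thesis by (simp add: emb_eq_iff)
    qed
    have sii: "s i (s i x) = - x" for x
      by (simp add: ii)
    have sr: "s (of_real r) x = r *\<^sub>R x" for r x by (rule scale_of_real)
    have si: "s i (r *\<^sub>R x) = r *\<^sub>R s i x" for r x
      by (simp flip: sr add: mult.commute)
    \<comment> \<open>the only complex-linear functional with real part \<open>f\<close>\<close>
    define g where "g x = of_real (f x) - i * of_real (f (s i x))" for x
    have add: "g (x + y) = g x + g y" for x y
      by (simp add: g_def scale_right_distrib fsimps algebra_simps)
    have real: "g (r *\<^sub>R x) = of_real r * g x" for r x
      by (simp add: g_def si fsimps algebra_simps)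
    have imag: "g (s i x) = i * g x" for x
    proof -
      have "i * g x = i * of_real (f x) - (i * i) * of_real (f (s i x))"
        by (simp add: g_def algebra_simps)
      also have "\<dots> = g (s i x)" unfolding ii g_def sii fsimps by simp
      finally show ?thesis by simp
    qed
    have "g (s a x) = a * g x" for a x
    proof -
      have "emb a = emb (of_real (Re (emb a)) + of_real (Im (emb a)) * i :: 'k)"
        by (simp add: emb_add emb_mult emb_of_real i complex_eq_iff)
      then have a: "a = of_real (Re (emb a)) + of_real (Im (emb a)) * i"
        by (simp only: emb_eq_iff)
      have "s a x = Re (emb a) *\<^sub>R x + Im (emb a) *\<^sub>R s i x"
        by (subst a) (simp only: scale_left_distrib scale_scale[symmetric] sr)
      then have "g (s a x) = (of_real (Re (emb a)) + of_real (Im (emb a)) * i) * g x"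
        by (simp add: add real imag distrib_right mult.assoc)
      then show ?thesis using a by simp
    qed
    moreover have "Re (emb (g x)) = f x" for x
      by (simp add: g_def emb_diff emb_mult emb_of_real i)
    moreover have "g w = 0" if "w \<in> W" for w
      using that f(2) subspace_scale[OF W that, of i] by (simp add: g_def)
    ultimately show ?thesis using add by blast
  qed
qed

text \<open>The harder half of James's characterisation of orthogonality, for a whole subspace at
  once; the converse is \<open>BJ_orthogonal_if_kernel\<close>.\<close>

lemma hahn_banach_BJ_orthogonal:
  fixes s :: "'k::real_or_complex \<Rightarrow> 'x::real_normed_vector \<Rightarrow> 'x"
  assumes s: "normed_space_over s" and W: "module.subspace s W" and u: "u \<noteq> 0"
    and orth: "\<And>w. w \<in> W \<Longrightarrow> BJ_orthogonal s u w"
  shows "\<exists>g\<in>support_functionals s u. W \<subseteq> kernel_of g"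
proof -
  interpret normed_space_over s by fact
  have "Real_Vector_Spaces.subspace W"
    unfolding Real_Vector_Spaces.subspace_def
    using W subspace_0 subspace_add subspace_scale by (metis scale_of_real)
  moreover have "norm u \<le> norm (u + w)" if "w \<in> W" for w
    using orth[OF that] scale_one unfolding BJ_orthogonal_def by metis
  ultimately obtain f where f: "linear f" "\<And>x. f x \<le> norm x" "f u = norm u"
      "\<And>w. w \<in> W \<Longrightarrow> f w = 0"
    using hahn_banach_orthogonal[of W u] by blast
  obtain g :: "'x \<Rightarrow> 'k" where g: "\<forall>x y. g (x + y) = g x + g y" "\<forall>a x. g (s a x) = a * g x"
      "\<And>x. Re (emb (g x)) = f x" "\<forall>w\<in>W. g w = 0"
    using complexify_functional[OF s W f(1,4)] by blast
  have le: "norm (g y) \<le> norm y" for y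
  proof (cases "g y = 0")
    case False
    \<comment> \<open>Rotating \<open>y\<close> by the unimodular scalar \<open>c\<close> makes the
      value of \<open>g\<close> real and nonnegative, hence equal to the value of \<open>f\<close>,
      which is bounded by the norm.\<close>
    define c where "c = of_real (norm (g y)) / g y"
    have "norm c = 1" using False by (simp add: c_def norm_divide)
    have "g (s c y) = of_real (norm (g y))" using g(2) False by (simp add: c_def)
    then have "norm (g y) = f (s c y)" using g(3)[of "s c y"] by (simp add: emb_of_real)
    also have "\<dots> \<le> norm (s c y)" by (rule f(2))
    also have "\<dots> = norm y" by (simp add: norm_scale \<open>norm c = 1\<close>)
    finally show ?thesis .
  qed simp
  have "g u = of_real (norm u)"
    by (rule eq_of_real_if_Re_ge) (use le g(3) f(3) in auto)
  then have "g \<in> support_functionals s u"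
    using u g le by (simp add: support_functionals_iff[OF s])
  then show ?thesis using g(4) by (auto simp: kernel_of_def)
qed

text \<open>\<open>f\<close> has the constant value \<open>norm x\<close> on the line through
  \<open>x\<close> in direction \<open>z\<close>, and it never exceeds the norm in modulus.\<close>

lemma BJ_orthogonal_if_kernel:
  assumes s: "normed_space_over s" and f: "f \<in> support_functionals s x" and z: "f z = 0"
  shows "BJ_orthogonal s x z"
  unfolding BJ_orthogonal_def
proof
  fix a
  note f = f[unfolded support_functionals_iff[OF s]]
  have "f (x + s a z) = of_real (norm x)" using f z by simp
  then show "norm x \<le> norm (x + s a z)"
    using f by (metis norm_of_real abs_norm_cancel)
qed

subsection \<open>Semi-inner products and level vectors\<close>

lemma semi_inner_product_same:
  assumes "semi_inner_product s p"
  shows "p x x = of_real ((norm x)\<^sup>2)"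
proof (cases "x = 0")
  case True
  \<comment> \<open>Positivity says nothing at 0. Compatibility with the norm gives real part 0, and
    then the Cauchy-Schwarz inequality makes the value itself 0.\<close>
  have "Re (emb (p x x)) = 0"
    using assms True unfolding semi_inner_product_def by (metis norm_zero real_sqrt_eq_0_iff)
  moreover have "(norm (p x x))\<^sup>2 \<le> Re (emb (p x x)) * Re (emb (p x x))"
    using assms unfolding semi_inner_product_def by blast
  ultimately show ?thesis using True by simp
next
  case False
  then obtain r where "r > 0" "p x x = of_real r"
    using assms unfolding semi_inner_product_def by blast
  moreover have "norm x = sqrt (Re (emb (p x x)))"
    using assms unfolding semi_inner_product_def by blast
  ultimately show ?thesis by (simp add: emb_of_real del: of_real_power)
qed

text \<open>The Cauchy-Schwarz inequality reads \<open>norm (p y x) \<le> norm y * norm x\<close>,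
  with equality at \<open>y = x\<close>.\<close>

lemma semi_inner_product_support:
  assumes s: "normed_space_over s" and p: "semi_inner_product s p" and x: "x \<noteq> 0"
  shows "(\<lambda>y. p y x / of_real (norm x)) \<in> support_functionals s x"
proof -
  interpret normed_space_over s by fact
  have lin: "p (s a y + s b z) x = a * p y x + b * p z x" for a b y z
    using p unfolding semi_inner_product_def by blast
  have "(norm (p y x))\<^sup>2 \<le> (norm y * norm x)\<^sup>2" for y
  proof -
    have "(norm (p y x))\<^sup>2 \<le> Re (emb (p y y)) * Re (emb (p x x))"
      using p unfolding semi_inner_product_def by blast
    then show ?thesis
      by (simp add: semi_inner_product_same[OF p] emb_of_real power_mult_distrib
          del: of_real_power)
  qed
  then have le: "norm (p y x) \<le> norm y * norm x" for y
    by (rule power2_le_imp_le) simp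
  have add: "p (y + z) x = p y x + p z x" for y z
    using lin[of 1 y 1 z] by simp
  have scale: "p (s a y) x = a * p y x" for a y
    using lin[of a y 0 0] by simp
  show ?thesis
    unfolding support_functionals_iff[OF s]
  proof (intro conjI allI)
    show "norm (p y x / of_real (norm x)) \<le> norm y" for y
      using le[of y] x by (simp add: norm_divide divide_le_eq)
    show "p x x / of_real (norm x) = of_real (norm x)"
      using x by (simp add: semi_inner_product_same[OF p] power2_eq_square)
  qed (simp_all add: x add scale add_divide_distrib)
qed

text \<open>Only the values \<open>p y (a x)\<close> are changed.  Since \<open>f (a x) = a \<parallel>x\<parallel>\<close>, the product
  \<open>kcnj (f z) * f y\<close> is the conjugate homogeneous choice for \<open>z = a x\<close>.\<close>

lemma semi_inner_product_prescribed:
  assumes s: "normed_space_over s" and p: "semi_inner_product s p"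
    and f: "f \<in> support_functionals s x"
  shows "\<exists>p'. semi_inner_product s p' \<and> (\<forall>y. p' y x = of_real (norm x) * f y)"
proof -
  interpret normed_space_over s by fact
  note f = f[unfolded support_functionals_iff[OF s]]
  define L where "L = range (\<lambda>a. s a x)"
  define p' where "p' y z = (if z \<in> L then kcnj (f z) * f y else p y z)" for y z
  have norm_f: "norm (f z) = norm z" if "z \<in> L" for z
    using that f by (auto simp: L_def norm_mult norm_scale)
  have same: "p' z z = of_real ((norm z)\<^sup>2)" for z
    using norm_f[of z] by (simp add: p'_def kcnj_mult_self semi_inner_product_same[OF p])
  \<comment> \<open>Nonzero scalars preserve both \<open>L\<close> and its complement, so conjugate
    homogeneity can be checked on each separately. The scalar 0 is a case of its own, as it sends
    every point into \<open>L\<close>.\<close>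
  have L: "s a z \<in> L \<longleftrightarrow> z \<in> L" if "a \<noteq> 0" for a z
  proof
    assume "s a z \<in> L"
    then obtain b where "s a z = s b x" by (auto simp: L_def)
    then have "s (inverse a) (s a z) = s (inverse a * b) x" by simp
    then have "z = s (inverse a * b) x" using that by simp
    then show "z \<in> L" by (auto simp: L_def)
  qed (auto simp: L_def)
  have zero: "0 \<in> L" using scale_zero_left[of x] unfolding L_def by (metis rangeI)
  have "semi_inner_product s p'"
    unfolding semi_inner_product_def
  proof (intro conjI allI impI)
    show "p' (s a y + s b z) w = a * p' y w + b * p' z w" for a b y z w
      using p f by (simp add: p'_def semi_inner_product_def algebra_simps)
    show "\<exists>r>0. p' z z = of_real r" if "z \<noteq> 0" for z
      by (rule exI[of _ "(norm z)\<^sup>2"]) (simp add: same that)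
    show "(norm (p' y z))\<^sup>2 \<le> Re (emb (p' y y)) * Re (emb (p' z z))" for y z
    proof (cases "z \<in> L")
      case True
      then have "norm (p' y z) \<le> norm z * norm y"
        using f by (simp add: p'_def norm_mult norm_kcnj norm_f mult_left_mono)
      then have "(norm (p' y z))\<^sup>2 \<le> (norm z * norm y)\<^sup>2" by (simp add: power_mono)
      then show ?thesis by (simp add: same emb_of_real power_mult_distrib mult.commute
            del: of_real_power)
    next
      case False
      have "(norm (p y z))\<^sup>2 \<le> Re (emb (p y y)) * Re (emb (p z z))"
        using p unfolding semi_inner_product_def by blast
      then show ?thesis
        using False by (simp add: same semi_inner_product_same[OF p]) (simp add: p'_def)
    qed
    show "emb (p' y (s a z)) = cnj (emb a) * emb (p' y z)" for a y z
    proof (cases "a = 0")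
      case True
      have "f 0 = 0" using f by (metis norm_le_zero_iff norm_zero)
      then have "kcnj (f 0) = 0" by (metis norm_eq_zero norm_kcnj)
      then show ?thesis using True zero by (simp add: p'_def emb_zero)
    next
      case False
      then show ?thesis
        using L[of a z] f p by (simp add: p'_def emb_mult emb_kcnj semi_inner_product_def)
    qed
    show "norm z = sqrt (Re (emb (p' z z)))" for z
      by (simp add: same emb_of_real del: of_real_power)
  qed
  moreover have "x \<in> L" using scale_one[of x] unfolding L_def by (metis rangeI)
  then have "p' y x = of_real (norm x) * f y" for y
    using f by (simp add: p'_def kcnj_of_real)
  ultimately show ?thesis by blast
qed

text \<open>The functionals are the normalised semi-inner products at \<open>x\<close> and
  \<open>T x\<close>. Taking \<open>y = x\<close> in the level identity determines the level number
  as the squared ratio of the norms of \<open>T x\<close> and \<open>x\<close>.\<close>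

lemma level_vector_support:
  fixes sX :: "'k::real_or_complex \<Rightarrow> 'x::real_normed_vector \<Rightarrow> 'x"
    and sY :: "'k \<Rightarrow> 'y::real_normed_vector \<Rightarrow> 'y"
  assumes sX: "normed_space_over sX" and sY: "normed_space_over sY"
    and lev: "level_vector sX sY T x" and nz: "T x \<noteq> 0"
  shows "\<exists>h\<in>support_functionals sX x. \<exists>g\<in>support_functionals sY (T x).
    \<forall>y. g (T y) = of_real (norm (T x) / norm x) * h y"
proof -
  obtain k p q where x: "x \<noteq> 0" and p: "semi_inner_product sX p" and q: "semi_inner_product sY q"
    and k: "\<And>y. q (T y) (T x) = k * p y x"
    using lev unfolding level_vector_def level_number_def by blast
  have "of_real ((norm (T x))\<^sup>2) = k * of_real ((norm x)\<^sup>2)"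
    using k[of x] by (simp add: semi_inner_product_same[OF p] semi_inner_product_same[OF q])
  then have k': "k = of_real ((norm (T x))\<^sup>2 / (norm x)\<^sup>2)"
    using x by (simp add: field_simps)
  show ?thesis
  proof (intro bexI allI)
    show "(\<lambda>y. p y x / of_real (norm x)) \<in> support_functionals sX x"
      by (rule semi_inner_product_support[OF sX p x])
    show "(\<lambda>y. q y (T x) / of_real (norm (T x))) \<in> support_functionals sY (T x)"
      by (rule semi_inner_product_support[OF sY q nz])
    show "q (T y) (T x) / of_real (norm (T x)) =
        of_real (norm (T x) / norm x) * (p y x / of_real (norm x))" for y
      using x nz by (simp add: k k' power2_eq_square)
  qed
qed

text \<open>Converse of \<open>level_vector_support\<close>: \<open>p\<close> and \<open>q\<close>
  are starting points, altered along the lines through \<open>x\<close> and \<open>T x\<close> so as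
  to induce \<open>h\<close> and \<open>g\<close> there.\<close>

lemma level_vector_if_support:
  fixes sX :: "'k::real_or_complex \<Rightarrow> 'x::real_normed_vector \<Rightarrow> 'x"
    and sY :: "'k \<Rightarrow> 'y::real_normed_vector \<Rightarrow> 'y"
  assumes sX: "normed_space_over sX" and sY: "normed_space_over sY"
    and p: "semi_inner_product sX p" and q: "semi_inner_product sY q"
    and h: "h \<in> support_functionals sX x" and g: "g \<in> support_functionals sY (T x)"
    and eq: "\<And>y. g (T y) = of_real c * h y"
  shows "level_vector sX sY T x"
proof -
  obtain p' where p': "semi_inner_product sX p'" "\<And>y. p' y x = of_real (norm x) * h y"
    using semi_inner_product_prescribed[OF sX p h] by blast
  obtain q' where q': "semi_inner_product sY q'" "\<And>y. q' y (T x) = of_real (norm (T x)) * g y"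
    using semi_inner_product_prescribed[OF sY q g] by blast
  have x: "x \<noteq> 0" using h by (simp add: support_functionals_def)
  then have "q' (T y) (T x) = of_real (norm (T x) * c / norm x) * p' y x" for y
    by (simp add: p' q' eq)
  then show ?thesis
    unfolding level_vector_def level_number_def using x p'(1) q'(1) by blast
qed

text \<open>Conjugate homogeneity gives \<open>q y 0 = 0\<close>, so 0 is a level number, whatever
  \<open>p\<close> and \<open>q\<close> are.\<close>

lemma level_vector_if_image_zero:
  fixes sX :: "'k::real_or_complex \<Rightarrow> 'x::real_normed_vector \<Rightarrow> 'x"
    and sY :: "'k \<Rightarrow> 'y::real_normed_vector \<Rightarrow> 'y"
  assumes sY: "normed_space_over sY"
    and p: "semi_inner_product sX p" and q: "semi_inner_product sY q"
    and x: "x \<noteq> 0" "T x = 0"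
  shows "level_vector sX sY T x"
proof -
  interpret normed_space_over sY by fact
  have "emb (q y (sY 0 0)) = cnj (emb (0::'k)) * emb (q y 0)" for y
    using q unfolding semi_inner_product_def by blast
  then have "emb (q y 0) = 0" for y by (simp add: emb_zero)
  then have "q y 0 = 0" for y
    by (metis emb_eq_iff emb_zero)
  then have "\<forall>y. q (T y) (T x) = 0 * p y x" using x by simp
  then show ?thesis
    unfolding level_vector_def level_number_def using p q x by blast
qed

subsection \<open>Faces\<close>

text \<open>The set is the face exposed by \<open>f\<close>. On the sphere the real part of
  \<open>f\<close> is at most 1, so a proper convex combination can reach 1 only if both endpoints
  do.\<close>

lemma face_unit_ball_support:
  fixes s :: "'k::real_or_complex \<Rightarrow> 'x::real_normed_vector \<Rightarrow> 'x"
  assumes s: "normed_space_over s" and f: "f \<in> support_functionals s x"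
  shows "face_unit_ball {v \<in> sphere 0 1. f v = 1}"
proof -
  interpret normed_space_over s by fact
  note f = f[unfolded support_functionals_iff[OF s]]
  have comb: "f (a *\<^sub>R u + b *\<^sub>R v) = of_real a * f u + of_real b * f v" for a b u v
    using f by (simp flip: scale_of_real)
  have one: "norm v = 1" if "f v = 1" "norm v \<le> 1" for v
  proof -
    have "norm (f v) \<le> norm v" using f by blast
    then show ?thesis using that by simp
  qed
  have le: "Re (emb (f v)) \<le> 1" if "norm v = 1" for v
  proof -
    have "Re (emb (f v)) \<le> cmod (emb (f v))" by (rule complex_Re_le_cmod)
    also have "\<dots> \<le> 1" using f that by (metis norm_emb)
    finally show ?thesis .
  qed
  have eq: "f v = 1" if "norm v = 1" "1 \<le> Re (emb (f v))" for v
    using eq_of_real_if_Re_ge[of "f v" 1] f that by (metis of_real_1)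
  show ?thesis
    unfolding face_unit_ball_def
  proof (intro conjI ballI allI impI)
    show "convex {v \<in> sphere 0 1. f v = 1}"
    proof (rule convexI)
      fix u v and a b :: real
      assume uv: "u \<in> {v \<in> sphere 0 1. f v = 1}" "v \<in> {v \<in> sphere 0 1. f v = 1}"
        and ab: "0 \<le> a" "0 \<le> b" "a + b = 1"
      have "f (a *\<^sub>R u + b *\<^sub>R v) = 1"
        using uv ab(3) by (simp add: comb flip: of_real_add)
      moreover have "norm (a *\<^sub>R u + b *\<^sub>R v) \<le> 1"
        using norm_triangle_ineq[of "a *\<^sub>R u" "b *\<^sub>R v"] uv ab by simp
      ultimately show "a *\<^sub>R u + b *\<^sub>R v \<in> {v \<in> sphere 0 1. f v = 1}" using one by simp
    qed
  next
    fix u v and t :: real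
    assume u: "u \<in> sphere 0 1" and v: "v \<in> sphere 0 1"
      and t: "0 < t \<and> t < 1 \<and> (1 - t) *\<^sub>R u + t *\<^sub>R v \<in> {v \<in> sphere 0 1. f v = 1}"
    then have "Re (emb (of_real (1 - t) * f u + of_real t * f v)) = 1"
      using comb[of "1 - t" u t v] by (simp add: emb_one)
    then have sum: "(1 - t) * Re (emb (f u)) + t * Re (emb (f v)) = 1"
      by (simp add: emb_add emb_mult emb_of_real del: of_real_diff)
    have ru: "Re (emb (f u)) \<le> 1" and rv: "Re (emb (f v)) \<le> 1"
      using u v le by auto
    then have eq1: "t * (Re (emb (f v)) - 1) = (1 - t) * (1 - Re (emb (f u)))"
      using sum by (simp add: algebra_simps)
    have "0 \<le> t * (Re (emb (f v)) - 1)"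
      unfolding eq1 using t ru by simp
    then have "1 \<le> Re (emb (f v))" using t by (simp add: zero_le_mult_iff)
    moreover have "(1 - t) * (1 - Re (emb (f u))) \<le> 0"
      unfolding eq1[symmetric] using t rv by (simp add: mult_nonneg_nonpos)
    then have "1 \<le> Re (emb (f u))" using t by (simp add: mult_le_0_iff)
    ultimately show "u \<in> {v \<in> sphere 0 1. f v = 1}" "v \<in> {v \<in> sphere 0 1. f v = 1}"
      using u v eq by auto
  qed auto
qed

text \<open>The segment from \<open>y\<close> to \<open>x\<close> extends beyond \<open>x\<close> to
  a point \<open>w\<close> of \<open>F\<close>. The real part of \<open>f\<close> is at most 1 at
  both ends and equals 1 at \<open>x\<close> in between, so it equals 1 at \<open>y\<close>.\<close>

lemma support_rel_interior_face:
  fixes s :: "'k::real_or_complex \<Rightarrow> 'x::real_normed_vector \<Rightarrow> 'x"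
  assumes s: "normed_space_over s" and F: "face_unit_ball F"
    and x: "x \<in> rel_interior_over s F" and y: "y \<in> F"
    and f: "f \<in> support_functionals s x"
  shows "f \<in> support_functionals s y"
proof -
  interpret normed_space_over s by fact
  note f = f[unfolded support_functionals_iff[OF s]]
  obtain e where xF: "x \<in> F" and e: "e > 0" "ball x e \<inter> aff_over s F \<subseteq> F"
    using x unfolding rel_interior_over_def by blast
  have norm: "norm v = 1" if "v \<in> F" for v
  proof -
    have "v \<in> sphere 0 1" using that F unfolding face_unit_ball_def by blast
    then show ?thesis by simp
  qed
  \<comment> \<open>Small enough to keep \<open>w\<close> in the ball around \<open>x\<close>; the
    added 1 keeps the denominator positive when \<open>y = x\<close>.\<close>
  define d where "d = e / (2 * (norm (y - x) + 1))"
  have d: "d > 0" using e by (simp add: d_def add_nonneg_pos)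
  have "d * norm (y - x) \<le> d * (norm (y - x) + 1)" using d by simp
  also have "\<dots> = e / 2"
    using norm_ge_zero[of "y - x"] by (simp add: d_def field_simps add_nonneg_eq_0_iff)
  also have "\<dots> < e" using e by simp
  finally have "d * norm (y - x) < e" .
  define w where "w = x - d *\<^sub>R (y - x)"
  \<comment> \<open>\<open>w\<close> is a combination of \<open>x\<close> and \<open>y\<close> with
    real coefficients of sum 1, so it lies in every affine space containing \<open>F\<close>, for
    either scalar field.\<close>
  have "w \<in> aff_over s F"
    unfolding aff_over_def
  proof
    fix M assume "M \<in> {M. affine_space_over s M \<and> F \<subseteq> M}"
    then obtain a V where V: "subspace V" "M = (\<lambda>v. a + v) ` V" and "F \<subseteq> M"
      unfolding affine_space_over_def by blast
    then obtain v1 v2 where v: "v1 \<in> V" "x = a + v1" "v2 \<in> V" "y = a + v2"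
      using xF y by blast
    have "w = a + (v1 - s (of_real d) (v2 - v1))"
      by (simp add: w_def v scale_of_real)
    moreover have "v1 - s (of_real d) (v2 - v1) \<in> V"
      by (intro subspace_diff subspace_scale V v)
    ultimately show "w \<in> M" using V by blast
  qed
  moreover have "w \<in> ball x e"
    using \<open>d * norm (y - x) < e\<close> d by (simp add: w_def dist_norm)
  ultimately have wF: "w \<in> F" using e by blast
  have "f w + of_real d * (f y - f x) = f x"
  proof -
    have "f (y - x) + f x = f y" using f by (metis diff_add_cancel)
    then have "f (y - x) = f y - f x" by (simp add: eq_diff_eq)
    moreover have "f (w + s (of_real d) (y - x)) = f w + of_real d * f (y - x)"
      using f by simp
    moreover have "w + s (of_real d) (y - x) = x" by (simp add: w_def scale_of_real)
    ultimately show ?thesis by simp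
  qed
  moreover have fx: "f x = of_real 1" using f norm[OF xF] by simp
  ultimately have "Re (emb (f w + of_real d * (f y - 1))) = 1" by (simp add: emb_one)
  then have sum: "Re (emb (f w)) + d * (Re (emb (f y)) - 1) = 1"
    by (simp add: emb_add emb_mult emb_of_real emb_diff emb_one)
  have "Re (emb (f w)) \<le> cmod (emb (f w))" by (rule complex_Re_le_cmod)
  also have "\<dots> \<le> 1" using f norm[OF wF] by (metis norm_emb)
  finally have "0 \<le> d * (Re (emb (f y)) - 1)" using sum by simp
  then have "1 \<le> Re (emb (f y))" using d by (simp add: zero_le_mult_iff)
  moreover have "norm (f y) \<le> 1" using f norm[OF y] by metis
  ultimately have "f y = of_real 1" by (intro eq_of_real_if_Re_ge)
  moreover have "y \<noteq> 0" using norm[OF y] by auto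
  ultimately show ?thesis
    using f norm[OF y] by (simp add: support_functionals_iff[OF s])
qed

lemma bounded_linear_over_linear:
  assumes sX: "normed_space_over sX" and sY: "normed_space_over sY"
    and T: "bounded_linear_over sX sY T"
  shows "linear T"
proof (rule linearI)
  show "T (x + y) = T x + T y" for x y
    using T unfolding bounded_linear_over_def Vector_Spaces.linear_iff by blast
  show "T (r *\<^sub>R x) = r *\<^sub>R T x" for r x
    using T unfolding bounded_linear_over_def Vector_Spaces.linear_iff
    by (metis normed_space_over.scale_of_real[OF sX] normed_space_over.scale_of_real[OF sY])
qed

lemma level_vector_face_support:
  fixes sX :: "'k::real_or_complex \<Rightarrow> 'x::real_normed_vector \<Rightarrow> 'x"
    and sY :: "'k \<Rightarrow> 'y::real_normed_vector \<Rightarrow> 'y"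
  assumes sX: "normed_space_over sX" and sY: "normed_space_over sY" and F: "face_unit_ball F"
    and x: "x \<in> rel_interior_over sX F" "level_vector sX sY T x" "T x \<noteq> 0"
  shows "\<exists>h g. (\<forall>y\<in>F. h \<in> support_functionals sX y) \<and> g \<in> support_functionals sY (T x) \<and>
    (\<forall>y. g (T y) = of_real (norm (T x)) * h y) \<and> (\<forall>y\<in>F. g (T y) = of_real (norm (T x)))"
proof -
  have norm: "norm y = 1" if "y \<in> F" for y
  proof -
    have "y \<in> sphere 0 1" using that F unfolding face_unit_ball_def by blast
    then show ?thesis by simp
  qed
  have "x \<in> F" using x(1) by (simp add: rel_interior_over_def)
  then obtain h g where h: "h \<in> support_functionals sX x" and g: "g \<in> support_functionals sY (T x)"
    and eq: "\<And>y. g (T y) = of_real (norm (T x)) * h y"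
    using level_vector_support[OF sX sY x(2,3)] norm by fastforce
  have h': "h \<in> support_functionals sX y" if "y \<in> F" for y
    by (rule support_rel_interior_face[OF sX F x(1) that h])
  have "h y = 1" if "y \<in> F" for y
    using h'[OF that] norm[OF that] by (simp add: support_functionals_def)
  then have "\<forall>y\<in>F. g (T y) = of_real (norm (T x))" by (simp add: eq)
  then show ?thesis using h' g eq by blast
qed

text \<open>\<open>g\<close> is bounded by the norm and has the value \<open>norm (T x)\<close> at
  \<open>T y\<close>. Exchanging two such level vectors gives equality.\<close>

lemma level_vector_face_norm_le:
  fixes sX :: "'k::real_or_complex \<Rightarrow> 'x::real_normed_vector \<Rightarrow> 'x"
    and sY :: "'k \<Rightarrow> 'y::real_normed_vector \<Rightarrow> 'y"
  assumes sX: "normed_space_over sX" and sY: "normed_space_over sY" and F: "face_unit_ball F"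
    and x: "x \<in> rel_interior_over sX F" "level_vector sX sY T x" and y: "y \<in> F"
  shows "norm (T x) \<le> norm (T y)"
proof (cases "T x = 0")
  case False
  then obtain g where g: "g \<in> support_functionals sY (T x)" "g (T y) = of_real (norm (T x))"
    using level_vector_face_support[OF sX sY F x] y by blast
  then have "norm (g (T y)) \<le> norm (T y)" unfolding support_functionals_iff[OF sY] by blast
  then show ?thesis using g(2) by simp
qed simp

theorem theorem2p12:
  fixes sX :: "'k::real_or_complex \<Rightarrow> 'x::real_normed_vector \<Rightarrow> 'x"
    and sY :: "'k \<Rightarrow> 'y::real_normed_vector \<Rightarrow> 'y"
    and F A :: "'x set"
    and T :: "'x \<Rightarrow> 'y"
  assumes "normed_space_over sX" and "normed_space_over sY"
    and "face_unit_ball F"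
    and "bounded_linear_over sX sY T"
    and "A \<subseteq> rel_interior_over sX F"
    and "\<forall>a\<in>A. level_vector sX sY T a"
  shows "(\<forall>x\<in>A. \<forall>f\<in>support_functionals sX x. preserves_BJ_at sX sY T x (kernel_of f) \<longrightarrow>
            (\<forall>a\<in>A. preserves_BJ_at sX sY T a (kernel_of f)) \<and>
            (T ` A \<noteq> {0} \<longrightarrow>
              (\<exists>g\<in>(\<Inter>a\<in>A. support_functionals sY (T a)). T ` kernel_of f \<subseteq> kernel_of g)))
       \<and> (T ` A \<noteq> {0} \<longrightarrow>
            (\<exists>G. face_unit_ball G \<and> (\<forall>u\<in>A. T u /\<^sub>R norm (T u) \<in> G)))
       \<and> (\<forall>z\<in>convex hull A. level_vector sX sY T z)"
proof -
  note sX = assms(1) and sY = assms(2) and F = assms(3)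
  interpret X: normed_space_over sX by fact
  interpret Y: normed_space_over sY by fact
  have T: "linear T" by (rule bounded_linear_over_linear[OF assms(1,2,4)])
  have T_scale: "T (sX a y) = sY a (T y)" for a y
    using assms(4) unfolding bounded_linear_over_def Vector_Spaces.linear_iff by blast
  have A: "a \<in> rel_interior_over sX F" "level_vector sX sY T a" "a \<in> F" if "a \<in> A" for a
    using assms(5,6) that by (auto simp: rel_interior_over_def)
  have norm1: "norm y = 1" if "y \<in> F" for y
  proof -
    have "y \<in> sphere 0 1" using that F unfolding face_unit_ball_def by blast
    then show ?thesis by simp
  qed
  have norm_eq: "norm (T a) = norm (T b)" if "a \<in> A" "b \<in> A" for a b
    using level_vector_face_norm_le[OF sX sY F A(1,2)] A(3) that by (meson antisym)
  have nonzero: "T a \<noteq> 0" if nz: "T ` A \<noteq> {0}" and a: "a \<in> A" for a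
  proof
    assume "T a = 0"
    then have "T b = 0" if "b \<in> A" for b using norm_eq[OF that a] by simp
    then have "T ` A = {0}" using a by force
    then show False using nz by simp
  qed
  have part1: "(\<forall>a\<in>A. preserves_BJ_at sX sY T a (kernel_of f)) \<and>
      (T ` A \<noteq> {0} \<longrightarrow>
        (\<exists>g\<in>(\<Inter>a\<in>A. support_functionals sY (T a)). T ` kernel_of f \<subseteq> kernel_of g))"
    if x: "x \<in> A" and f: "f \<in> support_functionals sX x"
      and pres: "preserves_BJ_at sX sY T x (kernel_of f)" for x f
  proof -
    note f' = f[unfolded support_functionals_iff[OF sX]]
    have fF: "f \<in> support_functionals sX a" if "a \<in> A" for a
      by (rule support_rel_interior_face[OF sX F A(1)[OF x] A(3)[OF that] f])
    have ker: "X.subspace (kernel_of f)"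
      using pres unfolding preserves_BJ_at_def by blast
    have orth: "kernel_of f \<subseteq> {v. BJ_orthogonal sX a v}" if "a \<in> A" for a
      using BJ_orthogonal_if_kernel[OF sX fF[OF that]] by (auto simp: kernel_of_def)
    show ?thesis
    \<comment> \<open>If \<open>T x = 0\<close>, then \<open>T\<close> vanishes on \<open>A\<close>
      by equality of norms, and 0 is orthogonal to every vector.\<close>
    proof (cases "T x = 0")
      case True
      then have zero: "T a = 0" if "a \<in> A" for a using norm_eq[OF that x] by simp
      then have "T ` A = {0}" using x by force
      moreover have "preserves_BJ_at sX sY T a (kernel_of f)" if "a \<in> A" for a
        unfolding preserves_BJ_at_def using ker orth[OF that]
        by (simp add: zero[OF that] BJ_orthogonal_def[of sY])
      ultimately show ?thesis by blast
    next
      case False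
      \<comment> \<open>The Hahn-Banach theorem is applied to the whole image of the kernel, so that
        one \<open>g\<close> vanishes on all of it.\<close>
      have "Y.subspace (T ` kernel_of f)"
      proof (rule Y.subspaceI)
        show "0 \<in> T ` kernel_of f"
          using linear_0[OF T] X.subspace_0[OF ker] by (metis image_eqI)
        show "u + v \<in> T ` kernel_of f" if "u \<in> T ` kernel_of f" "v \<in> T ` kernel_of f" for u v
          using that X.subspace_add[OF ker] by (auto simp flip: linear_add[OF T])
        show "sY c u \<in> T ` kernel_of f" if "u \<in> T ` kernel_of f" for c u
          using that X.subspace_scale[OF ker] by (auto simp flip: T_scale)
      qed
      moreover have "BJ_orthogonal sY (T x) w" if "w \<in> T ` kernel_of f" for w
        using that pres unfolding preserves_BJ_at_def by blast
      ultimately obtain g where g: "g \<in> support_functionals sY (T x)"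
          "T ` kernel_of f \<subseteq> kernel_of g"
        using hahn_banach_BJ_orthogonal[OF sY _ False] by blast
      note g' = g(1)[unfolded support_functionals_iff[OF sY]]
      \<comment> \<open>\<open>f\<close> is 1 at both \<open>a\<close> and \<open>x\<close>, so
        \<open>a - x\<close> lies in its kernel and \<open>g\<close> agrees at \<open>T a\<close>
        and \<open>T x\<close>.\<close>
      have ga: "g \<in> support_functionals sY (T a)" if a: "a \<in> A" for a
      proof -
        have "f a = f x" using f' fF[OF a] norm1 A(3) x a
          by (simp add: support_functionals_iff[OF sX])
        moreover have "f (a - x) + f x = f a" using f' by (metis diff_add_cancel)
        ultimately have "a - x \<in> kernel_of f" by (simp add: kernel_of_def)
        then have "g (T (a - x)) = 0" using g(2) by (auto simp: kernel_of_def)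
        moreover have "g (T (a - x)) + g (T x) = g (T a)"
          using g' by (metis diff_add_cancel linear_add[OF T])
        ultimately have "g (T a) = of_real (norm (T a))"
          using g' norm_eq[OF a x] by simp
        moreover have "T a \<noteq> 0" using norm_eq[OF a x] False by auto
        ultimately show ?thesis using g' by (simp add: support_functionals_iff[OF sY])
      qed
      have "BJ_orthogonal sY (T a) (T z)" if "a \<in> A" "z \<in> kernel_of f" for a z
        by (rule BJ_orthogonal_if_kernel[OF sY ga[OF that(1)]])
          (use g(2) that(2) in \<open>auto simp: kernel_of_def\<close>)
      then have "preserves_BJ_at sX sY T a (kernel_of f)" if "a \<in> A" for a
        unfolding preserves_BJ_at_def using ker orth[OF that] that by blast
      then show ?thesis using ga g(2) by blast
    qed
  qed
  have part2: "\<exists>G. face_unit_ball G \<and> (\<forall>u\<in>A. T u /\<^sub>R norm (T u) \<in> G)" if nz: "T ` A \<noteq> {0}"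
  \<comment> \<open>The image of an empty \<open>A\<close> is not \<open>{0}\<close>, so a face is
    due in this case too; the empty face serves.\<close>
  proof (cases "A = {}")
    case True
    have "face_unit_ball ({} :: 'y set)" by (simp add: face_unit_ball_def)
    then show ?thesis using True by blast
  next
    case False
    then obtain x where x: "x \<in> A" by blast
    obtain g where g: "g \<in> support_functionals sY (T x)"
        "\<And>y. y \<in> F \<Longrightarrow> g (T y) = of_real (norm (T x))"
      using level_vector_face_support[OF sX sY F A(1,2)[OF x] nonzero[OF nz x]] by blast
    have "T u /\<^sub>R norm (T u) \<in> {v \<in> sphere 0 1. g v = 1}" if u: "u \<in> A" for u
    proof -
      have "g (sY (of_real (inverse (norm (T u)))) (T u)) = of_real (inverse (norm (T u))) * g (T u)"
        using g(1) unfolding support_functionals_iff[OF sY] by blast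
      moreover have "g (T u) = of_real (norm (T u))"
        using g(2)[OF A(3)[OF u]] norm_eq[OF u x] by simp
      ultimately have "g (T u /\<^sub>R norm (T u)) = 1"
        unfolding Y.scale_of_real using nonzero[OF nz u] by simp
      then show ?thesis using nonzero[OF nz u] by simp
    qed
    then show ?thesis using face_unit_ball_support[OF sY g(1)] by blast
  qed
  have part3: "level_vector sX sY T z" if z: "z \<in> convex hull A" for z
  proof -
    obtain x where x: "x \<in> A" using z by (metis convex_hull_empty empty_iff ex_in_conv)
    obtain p q where p: "semi_inner_product sX p" and q: "semi_inner_product sY q"
      using A(2)[OF x] unfolding level_vector_def level_number_def by blast
    have "convex F" using F unfolding face_unit_ball_def by blast
    then have "convex hull A \<subseteq> F" using A(3) by (intro hull_minimal) auto
    then have zF: "z \<in> F" using z by blast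
    then have z0: "z \<noteq> 0" using norm1 by force
    \<comment> \<open>Convexity of the ball bounds \<open>norm (T z)\<close> from above; the value
      of \<open>g\<close> at \<open>T z\<close> bounds it from below. Equality makes
      \<open>g\<close> a support functional at \<open>T z\<close>.\<close>
    have "convex hull A \<subseteq> T -` cball 0 (norm (T x))"
      by (rule hull_minimal)
        (use norm_eq[OF _ x] convex_linear_vimage[OF T convex_cball] in auto)
    then have Tz: "norm (T z) \<le> norm (T x)" using z by auto
    show ?thesis
    proof (cases "T x = 0")
      case True
      then show ?thesis using level_vector_if_image_zero[OF sY p q z0] Tz by simp
    next
      case False
      then obtain h g where h: "h \<in> support_functionals sX z"
        and g: "g \<in> support_functionals sY (T x)" "g (T z) = of_real (norm (T x))"
        and eq: "\<And>y. g (T y) = of_real (norm (T x)) * h y"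
        using level_vector_face_support[OF sX sY F A(1,2)[OF x]] zF by blast
      note g' = g(1)[unfolded support_functionals_iff[OF sY]]
      have "norm (g (T z)) \<le> norm (T z)" using g' by blast
      then have "norm (T z) = norm (T x)" using Tz g(2) by simp
      then have "g \<in> support_functionals sY (T z)"
        using g' g(2) by (auto simp: support_functionals_iff[OF sY])
      then show ?thesis by (rule level_vector_if_support[OF sX sY p q h _ eq])
    qed
  qed
  show ?thesis
  proof (intro conjI ballI impI)
    fix x f a
    assume "x \<in> A" "f \<in> support_functionals sX x" "preserves_BJ_at sX sY T x (kernel_of f)"
    note part1 = part1[OF this]
    show "preserves_BJ_at sX sY T a (kernel_of f)" if "a \<in> A"
      using part1 that by (rule conjunct1[THEN bspec])
    show "\<exists>g\<in>(\<Inter>a\<in>A. support_functionals sY (T a)). T ` kernel_of f \<subseteq> kernel_of g"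
      if "T ` A \<noteq> {0}"
      using part1 that by (rule conjunct2[THEN mp])
  qed (erule part2 part3)+
qed

end
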